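(* Let $A$ be a commutative algebra of finite dimension $n$ over an arbitrary field $\mathbb{F}$. Then there is an evolution $\mathbb{F}$-algebra $E$ of dimension $n+\varepsilon(A)$ and an algebra monomorphism $\Phi\colon A\hookrightarrow E$ such that $E^2\subseteq \Phi(A)$. Moreover, $E$ is of minimal dimension among evolution algebras embedding $A$: if $E'$ is any evolution $\mathbb{F}$-algebra for which there is an algebra monomorphism $A\hookrightarrow E'$, then $\dim E'\geq n+\varepsilon(A)$.
   Context: An algebra over a field $\mathbb{F}$ is an $\mathbb{F}$-vector space with a bilinear multiplication, not assumed associative or unital. Algebra morphisms are linear multiplicative maps (not required to preserve a unit). An algebra $E$ over $\mathbb{F}$ is an evolution algebra if it admits a basis $\{e_i : i\in I\}$, called a natural basis, such that $e_ie_j=0$ whenever $i\neq j$. $E^2$ denotes the linear span of all products $xy$ with $x,y\in E$. For a finite-dimensional commutative algebra $A$ and a basis $B=\{b_1,\dots,b_n\}$ of $A$, $\varepsilon_B(A)$ is the minimal non-negative integer $s$ such that there exist $v_1,\dots,v_s\in A$ and linear functionals $\beta_1,\dots,\beta_s\in A^*$ with $b_ib_j=\sum_{k=1}^s\beta_k(b_i)\beta_k(b_j)v_k$ for all $i\neq j$. Set $\varepsilon(A)=\min\{\varepsilon_B(A) : B \text{ a basis of } A\}$. *)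

theory Defs
  imports Complex_Main "HOL-Library.Extended_Nat" "HOL-Library.Poly_Mapping"
begin

text \<open>
  Algebras live on a subspace \<open>A\<close> of an ambient vector space, not on a whole type, so that the
  dimension of an algebra may depend on other data. The product is total on the ambient type, but
  only its values on \<open>A\<close> matter.
\<close>

locale nonassoc_algebra = vector_space scale
  for scale :: "'f::field \<Rightarrow> 'a::ab_group_add \<Rightarrow> 'a" (infixr \<open>*s\<close> 75) +
  fixes A :: "'a set"
    and mult :: "'a \<Rightarrow> 'a \<Rightarrow> 'a" (infixl \<open>\<cdot>\<close> 70)
  assumes subspace_A: "subspace A"
    and mult_closed: "\<lbrakk>x \<in> A; y \<in> A\<rbrakk> \<Longrightarrow> x \<cdot> y \<in> A"
    and mult_add_left: "\<lbrakk>x \<in> A; y \<in> A; z \<in> A\<rbrakk> \<Longrightarrow> (x + y) \<cdot> z = x \<cdot> z + y \<cdot> z"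
    and mult_add_right: "\<lbrakk>x \<in> A; y \<in> A; z \<in> A\<rbrakk> \<Longrightarrow> x \<cdot> (y + z) = x \<cdot> y + x \<cdot> z"
    and mult_scale_left: "\<lbrakk>x \<in> A; y \<in> A\<rbrakk> \<Longrightarrow> (c *s x) \<cdot> y = c *s (x \<cdot> y)"
    and mult_scale_right: "\<lbrakk>x \<in> A; y \<in> A\<rbrakk> \<Longrightarrow> x \<cdot> (c *s y) = c *s (x \<cdot> y)"
begin

definition is_basis :: "'a set \<Rightarrow> bool" where
  "is_basis B \<longleftrightarrow> independent B \<and> span B = A"

text \<open>\<^term>\<open>dim\<close> is \<open>0\<close> for infinite-dimensional spaces, hence the extended version.\<close>

definition alg_dim :: enat where
  "alg_dim = (if \<exists>B. finite B \<and> is_basis B then enat (dim A) else \<infinity>)"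

definition square :: "'a set" where
  "square = span {x \<cdot> y | x y. x \<in> A \<and> y \<in> A}"

definition natural_basis :: "'a set \<Rightarrow> bool" where
  "natural_basis B \<longleftrightarrow> is_basis B \<and> (\<forall>e\<in>B. \<forall>f\<in>B. e \<noteq> f \<longrightarrow> e \<cdot> f = 0)"

text \<open>Elements of the dual of \<open>A\<close>; values outside \<open>A\<close> are irrelevant.\<close>

definition linear_form :: "('a \<Rightarrow> 'f) \<Rightarrow> bool" where
  "linear_form \<beta> \<longleftrightarrow>
     (\<forall>x\<in>A. \<forall>y\<in>A. \<beta> (x + y) = \<beta> x + \<beta> y) \<and> (\<forall>c. \<forall>x\<in>A. \<beta> (c *s x) = c * \<beta> x)"

definition offdiag_decomposition ::
    "'a set \<Rightarrow> nat \<Rightarrow> (nat \<Rightarrow> 'a) \<Rightarrow> (nat \<Rightarrow> 'a \<Rightarrow> 'f) \<Rightarrow> bool" where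
  "offdiag_decomposition B s v \<beta> \<longleftrightarrow>
     (\<forall>k<s. v k \<in> A \<and> linear_form (\<beta> k)) \<and>
     (\<forall>b\<in>B. \<forall>b'\<in>B. b \<noteq> b' \<longrightarrow> b \<cdot> b' = (\<Sum>k<s. (\<beta> k b * \<beta> k b') *s v k))"

definition eps_basis :: "'a set \<Rightarrow> nat" where
  "eps_basis B = (LEAST s. \<exists>v \<beta>. offdiag_decomposition B s v \<beta>)"

definition eps :: nat where
  "eps = (LEAST s. \<exists>B. is_basis B \<and> s = eps_basis B)"

end

locale commutative_algebra = nonassoc_algebra +
  assumes mult_commute: "\<lbrakk>x \<in> A; y \<in> A\<rbrakk> \<Longrightarrow> x \<cdot> y = y \<cdot> x"

locale evolution_algebra = nonassoc_algebra +
  assumes ex_natural_basis: "\<exists>B. natural_basis B"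

locale algebra_monomorphism =
  dom: nonassoc_algebra sA A mA + cod: nonassoc_algebra sE E mE
  for sA :: "'f::field \<Rightarrow> 'a::ab_group_add \<Rightarrow> 'a" and A :: "'a set" and mA :: "'a \<Rightarrow> 'a \<Rightarrow> 'a"
    and sE :: "'f \<Rightarrow> 'e::ab_group_add \<Rightarrow> 'e" and E :: "'e set" and mE :: "'e \<Rightarrow> 'e \<Rightarrow> 'e" +
  fixes \<Phi> :: "'a \<Rightarrow> 'e"
  assumes maps_into: "x \<in> A \<Longrightarrow> \<Phi> x \<in> E"
    and map_add: "\<lbrakk>x \<in> A; y \<in> A\<rbrakk> \<Longrightarrow> \<Phi> (x + y) = \<Phi> x + \<Phi> y"
    and map_scale: "x \<in> A \<Longrightarrow> \<Phi> (sA c x) = sE c (\<Phi> x)"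
    and map_mult: "\<lbrakk>x \<in> A; y \<in> A\<rbrakk> \<Longrightarrow> \<Phi> (mA x y) = mE (\<Phi> x) (\<Phi> y)"
    and inj: "inj_on \<Phi> A"

text \<open>The minimum defining \<^term>\<open>nonassoc_algebra.eps_basis\<close> is attained for every finite basis.\<close>

lemma (in commutative_algebra) ex_offdiag_decomposition:
  assumes B: "is_basis B" and fin: "finite B"
  shows "\<exists>s v \<beta>. offdiag_decomposition B s v \<beta>"
proof -
  have ind: "independent B" and sp: "span B = A" using B by (auto simp: is_basis_def)
  have BA: "B \<subseteq> A" using sp span_superset by blast
  define P where "P = {X. \<exists>b\<in>B. \<exists>c\<in>B. b \<noteq> c \<and> X = {b, c}}"
  have finP: "finite P" by (rule finite_subset[of _ "Pow B"]) (auto simp: P_def fin)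
  define w where "w X = (SOME z. \<exists>b c. X = {b, c} \<and> b \<noteq> c \<and> z = b \<cdot> c)" for X
  define g where "g X x = (\<Sum>b\<in>X. representation B x b)" for X x
  obtain h where h: "bij_betw h {..<card P} P"
    using finP ex_bij_betw_nat_finite by (metis atLeast0LessThan)
  have w: "w {b, c} = b \<cdot> c" if "b \<in> B" "c \<in> B" "b \<noteq> c" for b c
  proof -
    have "\<exists>b' c'. {b, c} = {b', c'} \<and> b' \<noteq> c' \<and> w {b, c} = b' \<cdot> c'"
      unfolding w_def by (rule someI_ex) (use that in blast)
    then show ?thesis
      using that BA mult_commute by (metis doubleton_eq_iff subsetD)
  qed
  have lin: "linear_form (g X)" for X
    unfolding linear_form_def g_def
    by (auto simp: sp representation_add[OF ind] representation_scale[OF ind]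
        sum.distrib sum_distrib_left)
  have g: "g X b = (if b \<in> X then 1 else 0)" if "X \<in> P" "b \<in> B" for X b
  proof -
    have "finite X" using that by (auto simp: P_def)
    then show ?thesis
      unfolding g_def using representation_basis[OF ind that(2)] by (simp add: sum.delta)
  qed
  have "b \<cdot> c = (\<Sum>k<card P. (g (h k) b * g (h k) c) *s w (h k))"
    if bc: "b \<in> B" "c \<in> B" "b \<noteq> c" for b c
  proof -
    have PI: "{b, c} \<in> P" using bc by (auto simp: P_def)
    have "(\<Sum>k<card P. (g (h k) b * g (h k) c) *s w (h k)) = (\<Sum>X\<in>P. (g X b * g X c) *s w X)"
      using sum.reindex_bij_betw[OF h, of "\<lambda>X. (g X b * g X c) *s w X"] by simp
    also have "\<dots> = (\<Sum>X\<in>P. if X = {b, c} then w X else 0)"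
    proof (rule sum.cong[OF refl])
      fix X assume X: "X \<in> P"
      have "(b \<in> X \<and> c \<in> X) \<longleftrightarrow> X = {b, c}"
        using X bc by (auto simp: P_def)
      then show "(g X b * g X c) *s w X = (if X = {b, c} then w X else 0)"
        using g[OF X bc(1)] g[OF X bc(2)] by auto
    qed
    also have "\<dots> = b \<cdot> c" using PI finP w[OF bc] by (simp add: sum.delta)
    finally show ?thesis by simp
  qed
  moreover have "w (h k) \<in> A" if "k < card P" for k
  proof -
    have "h k \<in> P" using h that by (auto simp: bij_betw_def)
    then obtain b c where "b \<in> B" "c \<in> B" "b \<noteq> c" "h k = {b, c}" by (auto simp: P_def)
    then show ?thesis using w[of b c] BA mult_closed[of b c] by auto
  qed
  ultimately have "offdiag_decomposition B (card P) (\<lambda>k. w (h k)) (\<lambda>k. g (h k))"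
    unfolding offdiag_decomposition_def using lin by blast
  then show ?thesis by blast
qed

end

theory Submission imports Defs begin

text \<open>
  A finite-dimensional algebra \<open>A\<close> embeds into an evolution algebra with natural basis
  \<open>e\<^sub>1, \<dots>, e\<^sub>N\<close> as soon as its product has the form \<open>x y = \<Sum>\<^sub>k \<gamma>\<^sub>k(x) \<gamma>\<^sub>k(y) u\<^sub>k\<close> for \<open>N\<close> linear forms
  \<open>\<gamma>\<^sub>k\<close> separating the points of \<open>A\<close> and vectors \<open>u\<^sub>k\<close> of \<open>A\<close>: send \<open>x\<close> to \<open>\<Sum>\<^sub>k \<gamma>\<^sub>k(x) e\<^sub>k\<close> and let
  \<open>e\<^sub>k\<^sup>2\<close> be the image of \<open>u\<^sub>k\<close>. An off-diagonal decomposition of length \<open>s\<close> for a basis \<open>B\<close> gives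
  such a form with the \<open>n\<close> coordinate functions of \<open>B\<close> and the \<open>s\<close> forms \<open>\<beta>\<^sub>k\<close>, the vector attached to
  \<open>b \<in> B\<close> being \<open>b\<^sup>2 - \<Sum>\<^sub>k \<beta>\<^sub>k(b)\<^sup>2 v\<^sub>k\<close>.

  Conversely, let \<open>\<Phi>\<close> embed \<open>A\<close> into \<open>E'\<close> with finite natural basis \<open>C\<close>. By exchange, \<open>E'\<close> is the
  direct sum of \<open>\<Phi>(A)\<close> and the span of some \<open>J \<subseteq> C\<close>. Let \<open>\<pi>\<close> be the left inverse of \<open>\<Phi>\<close> that kills
  \<open>J\<close>. The vectors \<open>\<pi>(c)\<close>, \<open>c \<in> C - J\<close>, form a basis of \<open>A\<close>, and \<open>\<Phi>(\<pi>(c)) - c\<close> lies in the span of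
  \<open>J\<close>, so that only the \<open>e\<^sup>2\<close> with \<open>e \<in> J\<close> contribute to the products of different basis vectors.
\<close>

section \<open>Bases and products\<close>

context nonassoc_algebra
begin

lemma is_basis_subset: "is_basis B \<Longrightarrow> B \<subseteq> A"
  unfolding is_basis_def using span_superset by blast

lemma zero_mem: "0 \<in> A"
  by (rule subspace_0[OF subspace_A])

lemma sum_mem: "(\<And>i. i \<in> I \<Longrightarrow> f i \<in> A) \<Longrightarrow> sum f I \<in> A"
  by (rule subspace_sum[OF subspace_A])

lemma scale_mem: "x \<in> A \<Longrightarrow> c *s x \<in> A"
  by (rule subspace_scale[OF subspace_A])

lemma bases_equipotent:
  assumes "finite B" "is_basis B" "is_basis C"
  shows "finite C \<and> card C = card B"
  using assms independent_span_bound[of B C] independent_span_bound[of C B] span_superset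
  unfolding is_basis_def by (metis le_antisym)

text \<open>By equipotence one infinite basis excludes every finite one, so any basis at hand
  decides the dimension.\<close>

lemma alg_dim_eq:
  assumes "is_basis B"
  shows "alg_dim = (if finite B then enat (card B) else \<infinity>)"
proof (cases "finite B")
  case True
  have "dim A = card B"
    using assms dim_eq_card[of B A] span_span unfolding is_basis_def by metis
  then show ?thesis using True assms by (auto simp: alg_dim_def)
next
  case False
  then have "\<not> (\<exists>C. finite C \<and> is_basis C)"
    using bases_equipotent assms by blast
  then show ?thesis using False by (simp add: alg_dim_def)
qed

lemma alg_dim_eq_enat:
  assumes "alg_dim = enat n" "is_basis B"
  shows "finite B \<and> card B = n"
  using alg_dim_eq[OF assms(2)] assms(1) by (auto split: if_splits)

section \<open>Bilinear expansion of products\<close>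

lemma mult_0_left: "x \<in> A \<Longrightarrow> 0 \<cdot> x = 0"
  using mult_add_left[of 0 0 x] zero_mem by simp

lemma mult_0_right: "x \<in> A \<Longrightarrow> x \<cdot> 0 = 0"
  using mult_add_right[of x 0 0] zero_mem by simp

lemma mult_sum_left:
  assumes "\<And>i. i \<in> I \<Longrightarrow> f i \<in> A" "y \<in> A"
  shows "sum f I \<cdot> y = (\<Sum>i\<in>I. f i \<cdot> y)"
  using assms by (induction I rule: infinite_finite_induct) (auto simp: mult_0_left mult_add_left sum_mem)

lemma mult_sum_right:
  assumes "\<And>i. i \<in> I \<Longrightarrow> f i \<in> A" "y \<in> A"
  shows "y \<cdot> sum f I = (\<Sum>i\<in>I. y \<cdot> f i)"
  using assms by (induction I rule: infinite_finite_induct) (auto simp: mult_0_right mult_add_right sum_mem)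

lemma basis_expansion:
  assumes "is_basis B" "finite B" "x \<in> A"
  shows "x = (\<Sum>b\<in>B. representation B x b *s b)"
  using assms sum_representation_eq[of B x B] by (auto simp: is_basis_def)

lemma natural_basis_mult:
  assumes "natural_basis B" "finite B" "x \<in> A" "y \<in> A"
  shows "x \<cdot> y = (\<Sum>b\<in>B. (representation B x b * representation B y b) *s (b \<cdot> b))"
proof -
  have B: "is_basis B" and BA: "\<And>b. b \<in> B \<Longrightarrow> b \<in> A"
    and orth: "\<And>b c. \<lbrakk>b \<in> B; c \<in> B; b \<noteq> c\<rbrakk> \<Longrightarrow> b \<cdot> c = 0"
    using assms(1) is_basis_subset by (auto simp: natural_basis_def)
  let ?r = "representation B"
  have "x \<cdot> y = (\<Sum>b\<in>B. ?r x b *s b) \<cdot> (\<Sum>b\<in>B. ?r y b *s b)"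
    using basis_expansion[OF B assms(2)] assms(3,4) by metis
  also have "\<dots> = (\<Sum>b\<in>B. \<Sum>c\<in>B. (?r x b * ?r y c) *s (b \<cdot> c))"
    by (subst mult_sum_left)
      (simp_all add: mult_sum_right mult_scale_left mult_scale_right BA scale_mem sum_mem
        mult_closed scale_sum_right mult.commute)
  also have "\<dots> = (\<Sum>b\<in>B. \<Sum>c\<in>B. if c = b then (?r x b * ?r y b) *s (b \<cdot> b) else 0)"
    by (intro sum.cong refl) (use orth in auto)
  finally show ?thesis using assms(2) by simp
qed

section \<open>Linear forms and off-diagonal decompositions\<close>

lemma linear_form_add:
  "\<lbrakk>linear_form \<beta>; x \<in> A; y \<in> A\<rbrakk> \<Longrightarrow> \<beta> (x + y) = \<beta> x + \<beta> y"
  and linear_form_scale: "\<lbrakk>linear_form \<beta>; x \<in> A\<rbrakk> \<Longrightarrow> \<beta> (c *s x) = c * \<beta> x"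
  by (auto simp: linear_form_def)

lemma linear_form_0: "linear_form \<beta> \<Longrightarrow> \<beta> 0 = 0"
  using linear_form_scale[of \<beta> 0 0] zero_mem by simp

lemma linear_form_sum:
  "\<lbrakk>linear_form \<beta>; \<And>i. i \<in> I \<Longrightarrow> f i \<in> A\<rbrakk> \<Longrightarrow> \<beta> (sum f I) = (\<Sum>i\<in>I. \<beta> (f i))"
  by (induction I rule: infinite_finite_induct) (auto simp: linear_form_0 linear_form_add sum_mem)

lemma linear_form_representation:
  "is_basis B \<Longrightarrow> linear_form (\<lambda>x. representation B x b)"
  by (auto simp: linear_form_def is_basis_def representation_add representation_scale)

text \<open>
  Subtracting the right-hand side of the decomposition from the product gives a second product
  on \<open>A\<close>, for which \<open>B\<close> is a natural basis.
\<close>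

lemma offdiag_decomposition_mult:
  assumes B: "is_basis B" "finite B" and dec: "offdiag_decomposition B s v \<beta>"
    and xy: "x \<in> A" "y \<in> A"
  shows "x \<cdot> y =
    (\<Sum>b\<in>B. (representation B x b * representation B y b) *s
              (b \<cdot> b - (\<Sum>k<s. (\<beta> k b * \<beta> k b) *s v k)))
    + (\<Sum>k<s. (\<beta> k x * \<beta> k y) *s v k)"
proof -
  define R where "R x y = (\<Sum>k<s. (\<beta> k x * \<beta> k y) *s v k)" for x y
  define Q where "Q x y = x \<cdot> y - R x y" for x y
  have lf: "linear_form (\<beta> k)" and vA: "v k \<in> A" if "k < s" for k
    using dec that by (auto simp: offdiag_decomposition_def)
  interpret Q: nonassoc_algebra scale A Q
  proof
    fix x y assume "x \<in> A" "y \<in> A"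
    then show "Q x y \<in> A"
      unfolding Q_def R_def
      by (intro subspace_diff[OF subspace_A] mult_closed sum_mem scale_mem vA) auto
  next
    fix x y z assume "x \<in> A" "y \<in> A" "z \<in> A"
    then show "Q (x + y) z = Q x z + Q y z" "Q x (y + z) = Q x y + Q x z"
      by (simp_all add: Q_def R_def mult_add_left mult_add_right linear_form_add[OF lf]
          distrib_left distrib_right scale_left_distrib sum.distrib)
  next
    fix c x y assume "x \<in> A" "y \<in> A"
    then show "Q (c *s x) y = c *s Q x y" "Q x (c *s y) = c *s Q x y"
      by (simp_all add: Q_def R_def mult_scale_left mult_scale_right linear_form_scale[OF lf]
          scale_right_diff_distrib scale_sum_right mult_ac)
  qed (rule subspace_A)
  have "Q.natural_basis B"
    using B dec unfolding Q.natural_basis_def Q.is_basis_def is_basis_def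
    by (auto simp: Q_def R_def offdiag_decomposition_def)
  \<comment> \<open>Expanding \<open>Q x y\<close> along \<open>B\<close> leaves only the squares
    \<open>Q b b\<close>; adding \<open>R x y\<close> returns to the given product.\<close>
  from Q.natural_basis_mult[OF this B(2) xy] show ?thesis
    by (simp add: Q_def R_def algebra_simps)
qed

end

section \<open>The embedding\<close>

definition pm_scale :: "'f::field \<Rightarrow> (nat \<Rightarrow>\<^sub>0 'f) \<Rightarrow> (nat \<Rightarrow>\<^sub>0 'f)" where
  "pm_scale c = Poly_Mapping.map ((*) c)"

lemma lookup_pm_scale [simp]:
  "Poly_Mapping.lookup (pm_scale c p) k = c * Poly_Mapping.lookup p k"
  by (simp add: pm_scale_def Poly_Mapping.map.rep_eq when_def)

lemma vector_space_pm_scale: "vector_space pm_scale"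
  by standard (auto intro!: poly_mapping_eqI simp: lookup_add algebra_simps)

text \<open>The coordinate space of dimension \<open>N\<close>. The ambient type is the same for
  every \<open>N\<close>, which lets the dimension depend on \<open>eps\<close>.\<close>

definition pm_upto :: "nat \<Rightarrow> (nat \<Rightarrow>\<^sub>0 'f::field) set" where
  "pm_upto N = {p. \<forall>k\<ge>N. Poly_Mapping.lookup p k = 0}"

text \<open>The unit vectors are to form a natural basis; \<open>w k\<close> prescribes the square
  of the \<open>k\<close>-th one.\<close>

definition pm_mult ::
    "nat \<Rightarrow> (nat \<Rightarrow> nat \<Rightarrow>\<^sub>0 'f::field) \<Rightarrow> (nat \<Rightarrow>\<^sub>0 'f) \<Rightarrow> (nat \<Rightarrow>\<^sub>0 'f) \<Rightarrow> (nat \<Rightarrow>\<^sub>0 'f)" where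
  "pm_mult N w p q =
     (\<Sum>k<N. pm_scale (Poly_Mapping.lookup p k * Poly_Mapping.lookup q k) (w k))"

lemma lookup_sum_single:
  fixes N :: nat
  shows
  "Poly_Mapping.lookup (\<Sum>k<N. Poly_Mapping.single k (f k)) j = (if j < N then f j else 0)"
  by (simp add: lookup_sum lookup_single when_def)

lemma inj_on_single: "inj_on (\<lambda>k. Poly_Mapping.single k (1::'f::field)) I"
  by (rule inj_onI) (metis lookup_single_eq lookup_single_not_eq zero_neq_one)

lemma nonassoc_algebra_pm_upto:
  fixes w :: "nat \<Rightarrow> nat \<Rightarrow>\<^sub>0 'f::field"
  assumes "\<And>k. k < N \<Longrightarrow> w k \<in> pm_upto N"
  shows "nonassoc_algebra pm_scale (pm_upto N) (pm_mult N w)"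
proof -
  interpret vector_space "pm_scale :: 'f \<Rightarrow> _" by (rule vector_space_pm_scale)
  show ?thesis
  proof
    show "subspace (pm_upto N)"
      by (auto simp: subspace_def pm_upto_def lookup_add)
  next
    fix p q :: "nat \<Rightarrow>\<^sub>0 'f" assume "p \<in> pm_upto N" "q \<in> pm_upto N"
    show "pm_mult N w p q \<in> pm_upto N"
      using assms by (auto simp: pm_upto_def pm_mult_def lookup_sum)
  qed (auto simp: pm_mult_def lookup_add algebra_simps scale_left_distrib sum.distrib scale_sum_right)
qed

lemma natural_basis_singles:
  fixes w :: "nat \<Rightarrow> nat \<Rightarrow>\<^sub>0 'f::field"
  assumes "\<And>k. k < N \<Longrightarrow> w k \<in> pm_upto N"
  shows "nonassoc_algebra.natural_basis pm_scale (pm_upto N) (pm_mult N w)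
    ((\<lambda>k. Poly_Mapping.single k 1) ` {..<N})"
proof -
  interpret nonassoc_algebra pm_scale "pm_upto N" "pm_mult N w"
    by (rule nonassoc_algebra_pm_upto[OF assms])
  let ?e = "\<lambda>k. Poly_Mapping.single k (1::'f)"
  \<comment> \<open>In this form \<open>lookup_sum_single\<close> reads off the coefficients of a
    combination, for independence as well as for spanning.\<close>
  have exp: "(\<Sum>k<N. pm_scale (f k) (?e k)) = (\<Sum>k<N. Poly_Mapping.single k (f k))" for f
    by (intro sum.cong refl poly_mapping_eqI) (auto simp: lookup_single when_def)
  have "independent (?e ` {..<N})"
  proof (rule independent_if_scalars_zero)
    fix f x assume "(\<Sum>x\<in>?e ` {..<N}. pm_scale (f x) x) = 0" and x: "x \<in> ?e ` {..<N}"
    then have "(\<Sum>k<N. Poly_Mapping.single k (f (?e k))) = 0"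
      by (simp add: sum.reindex[OF inj_on_single] exp)
    then have "f (?e j) = 0" if "j < N" for j
      using lookup_sum_single[of "\<lambda>k. f (?e k)" N j] that by simp
    then show "f x = 0" using x by auto
  qed simp
  moreover have "?e ` {..<N} \<subseteq> pm_upto N"
    by (auto simp: pm_upto_def lookup_single when_def)
  moreover have "p \<in> span (?e ` {..<N})" if "p \<in> pm_upto N" for p
  proof -
    have "p = (\<Sum>k<N. pm_scale (Poly_Mapping.lookup p k) (?e k))"
      using that unfolding exp
      by (intro poly_mapping_eqI) (auto simp: lookup_sum_single pm_upto_def)
    also have "\<dots> \<in> span (?e ` {..<N})"
      by (intro span_sum span_scale span_base) auto
    finally show ?thesis .
  qed
  ultimately have "is_basis (?e ` {..<N})"
    using span_minimal[OF _ subspace_A] unfolding is_basis_def by blast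
  then show ?thesis
    by (auto simp: natural_basis_def pm_mult_def lookup_single when_def intro!: sum.neutral)
qed

text \<open>The forms \<open>\<gamma> k\<close> serve as the coordinates of \<open>\<Phi>\<close>,
  so the product formula becomes multiplicativity and \<open>sep\<close> becomes injectivity. The
  squares of the natural basis vectors are chosen in the image of \<open>A\<close>, hence so is the
  span of all products.\<close>

lemma (in nonassoc_algebra) evolution_embedding:
  assumes lf: "\<And>k. k < N \<Longrightarrow> linear_form (\<gamma> k)" and u: "\<And>k. k < N \<Longrightarrow> u k \<in> A"
    and mult: "\<And>x y. \<lbrakk>x \<in> A; y \<in> A\<rbrakk> \<Longrightarrow> x \<cdot> y = (\<Sum>k<N. (\<gamma> k x * \<gamma> k y) *s u k)"
    and sep: "\<And>x. \<lbrakk>x \<in> A; \<And>k. k < N \<Longrightarrow> \<gamma> k x = 0\<rbrakk> \<Longrightarrow> x = 0"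
  shows "\<exists>(sE :: 'f \<Rightarrow> (nat \<Rightarrow>\<^sub>0 'f) \<Rightarrow> (nat \<Rightarrow>\<^sub>0 'f)) E mE \<Phi>.
    evolution_algebra sE E mE \<and> nonassoc_algebra.alg_dim sE E = enat N \<and>
    algebra_monomorphism scale A mult sE E mE \<Phi> \<and> nonassoc_algebra.square sE E mE \<subseteq> \<Phi> ` A"
proof -
  define \<Phi> where "\<Phi> x = (\<Sum>k<N. Poly_Mapping.single k (\<gamma> k x))" for x
  define w where "w k = \<Phi> (u k)" for k
  have lookup_\<Phi>: "Poly_Mapping.lookup (\<Phi> x) k = (if k < N then \<gamma> k x else 0)" for x k
    by (simp add: \<Phi>_def lookup_sum_single)
  have \<Phi>_mem: "\<Phi> x \<in> pm_upto N" for x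
    by (simp add: pm_upto_def lookup_\<Phi>)
  have \<Phi>_add: "\<Phi> (x + y) = \<Phi> x + \<Phi> y" if "x \<in> A" "y \<in> A" for x y
    by (rule poly_mapping_eqI) (simp add: lookup_\<Phi> lookup_add linear_form_add[OF lf] that)
  have \<Phi>_scale: "\<Phi> (c *s x) = pm_scale c (\<Phi> x)" if "x \<in> A" for c x
    by (rule poly_mapping_eqI) (simp add: lookup_\<Phi> linear_form_scale[OF lf] that)
  have w: "w k \<in> pm_upto N" for k by (simp add: w_def \<Phi>_mem)
  interpret E: nonassoc_algebra pm_scale "pm_upto N" "pm_mult N w"
    by (rule nonassoc_algebra_pm_upto[OF w])
  note nat = natural_basis_singles[of N w, OF w]
  \<comment> \<open>This covers arbitrary \<open>p\<close> and \<open>q\<close>, not only images of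
    elements of \<open>A\<close>: it yields both multiplicativity and the inclusion of the
    square.\<close>
  have pm_mult_\<Phi>: "pm_mult N w p q = \<Phi> (\<Sum>k<N. (Poly_Mapping.lookup p k * Poly_Mapping.lookup q k) *s u k)"
    for p q
  proof (rule poly_mapping_eqI)
    fix k
    let ?c = "\<lambda>k. Poly_Mapping.lookup p k * Poly_Mapping.lookup q k"
    have "\<gamma> k (\<Sum>i<N. ?c i *s u i) = (\<Sum>i<N. ?c i * \<gamma> k (u i))" if "k < N"
      by (subst linear_form_sum[OF lf[OF that]])
        (auto simp: linear_form_scale[OF lf[OF that]] u scale_mem)
    then show "Poly_Mapping.lookup (pm_mult N w p q) k = Poly_Mapping.lookup
        (\<Phi> (\<Sum>k<N. ?c k *s u k)) k"
      by (cases "k < N") (simp_all add: pm_mult_def w_def lookup_\<Phi> lookup_sum)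
  qed
  have "evolution_algebra pm_scale (pm_upto N) (pm_mult N w)"
    by standard (rule exI, rule nat)
  moreover have "E.alg_dim = enat N"
    using E.alg_dim_eq[of "(\<lambda>k. Poly_Mapping.single k 1) ` {..<N}"] nat
    by (simp add: E.natural_basis_def card_image inj_on_single)
  moreover have "algebra_monomorphism scale A mult pm_scale (pm_upto N) (pm_mult N w) \<Phi>"
  proof
    fix x y assume "x \<in> A" "y \<in> A"
    then show "\<Phi> (x \<cdot> y) = pm_mult N w (\<Phi> x) (\<Phi> y)"
      by (simp add: pm_mult_\<Phi> lookup_\<Phi> mult)
  next
    show "inj_on \<Phi> A"
    proof (rule inj_onI)
      fix x y assume xy: "x \<in> A" "y \<in> A" and eq: "\<Phi> x = \<Phi> y"
      have "\<gamma> k (x - y) = 0" if k: "k < N" for k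
      proof -
        have "\<gamma> k x = \<gamma> k y" using lookup_\<Phi>[of x k] lookup_\<Phi>[of y k] eq k by simp
        then show ?thesis
          using linear_form_add[OF lf[OF k], of "x - y" y] xy subspace_diff[OF subspace_A] by simp
      qed
      then have "x - y = 0" using sep xy subspace_diff[OF subspace_A] by blast
      then show "x = y" by simp
    qed
  qed (simp_all add: \<Phi>_mem \<Phi>_add \<Phi>_scale)
  moreover have "E.square \<subseteq> \<Phi> ` A"
    unfolding E.square_def
  proof (rule E.span_minimal)
    show "{pm_mult N w x y |x y. x \<in> pm_upto N \<and> y \<in> pm_upto N} \<subseteq> \<Phi> ` A"
      using u by (auto simp: pm_mult_\<Phi> intro!: imageI sum_mem scale_mem)
    show "E.subspace (\<Phi> ` A)"
    proof (rule E.subspaceI)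
      have "\<Phi> 0 = 0" by (rule poly_mapping_eqI) (simp add: lookup_\<Phi> linear_form_0[OF lf])
      then show "0 \<in> \<Phi> ` A" using zero_mem by force
    qed (auto simp: \<Phi>_add[symmetric] \<Phi>_scale[symmetric] scale_mem subspace_add[OF subspace_A])
  qed
  ultimately show ?thesis by blast
qed

text \<open>A \<open>LEAST\<close> has its defining property once some value has it.
  \<open>C\<close> supplies such a value for the minimum over bases, and
  \<open>ex_offdiag_decomposition\<close> for the minimum over lengths; the latter is where
  commutativity enters.\<close>

lemma (in commutative_algebra) eps_attained:
  assumes "is_basis C" "finite C"
  obtains B v \<beta> where "is_basis B" "finite B" "card B = card C" "offdiag_decomposition B eps v \<beta>"
proof -
  have "\<exists>B. is_basis B \<and> eps = eps_basis B"
    using LeastI_ex[of "\<lambda>s. \<exists>B. is_basis B \<and> s = eps_basis B"] assms(1)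
    unfolding eps_def[symmetric] by blast
  then obtain B where B: "is_basis B" "eps = eps_basis B" by blast
  have fin: "finite B" "card B = card C" using bases_equipotent[OF assms(2,1) B(1)] by auto
  have "\<exists>v \<beta>. offdiag_decomposition B eps v \<beta>"
    using LeastI_ex[OF ex_offdiag_decomposition[OF B(1) fin(1)]]
    unfolding B(2) eps_basis_def .
  then show ?thesis using that B fin by blast
qed

lemma (in nonassoc_algebra) eps_le:
  assumes "is_basis B" "offdiag_decomposition B s v \<beta>"
  shows "eps \<le> s"
proof -
  have "eps \<le> eps_basis B" unfolding eps_def by (rule Least_le) (use assms in blast)
  also have "\<dots> \<le> s" unfolding eps_basis_def by (rule Least_le) (use assms in blast)
  finally show ?thesis .
qed

lemma sum_lessThan_add:
  fixes f :: "nat \<Rightarrow> 'b::comm_monoid_add"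
  shows "(\<Sum>k<n + s. f k) = (\<Sum>k<n. f k) + (\<Sum>k<s. f (n + k))"
  by (induction s) (simp_all add: add.assoc)

lemma (in nonassoc_algebra) offdiag_decomposition_embedding:
  assumes B: "is_basis B" "finite B" and dec: "offdiag_decomposition B s v \<beta>"
  shows "\<exists>(sE :: 'f \<Rightarrow> (nat \<Rightarrow>\<^sub>0 'f) \<Rightarrow> (nat \<Rightarrow>\<^sub>0 'f)) E mE \<Phi>.
    evolution_algebra sE E mE \<and> nonassoc_algebra.alg_dim sE E = enat (card B + s) \<and>
    algebra_monomorphism scale A mult sE E mE \<Phi> \<and> nonassoc_algebra.square sE E mE \<subseteq> \<Phi> ` A"
proof -
  let ?n = "card B"
  obtain h where h: "bij_betw h {..<?n} B"
    using B(2) ex_bij_betw_nat_finite by (metis atLeast0LessThan)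
  have hB: "h k \<in> B" if "k < ?n" for k using h that by (auto simp: bij_betw_def)
  have lf: "linear_form (\<beta> k)" and vA: "v k \<in> A" if "k < s" for k
    using dec that by (auto simp: offdiag_decomposition_def)
  define u' where "u' b = b \<cdot> b - (\<Sum>k<s. (\<beta> k b * \<beta> k b) *s v k)" for b
  \<comment> \<open>Indices below \<open>?n\<close> carry the coordinates with respect to
    \<open>B\<close>; the forms \<open>\<beta>\<close> follow, shifted by \<open>?n\<close>.\<close>
  define \<gamma> where "\<gamma> k = (if k < ?n then (\<lambda>x. representation B x (h k)) else \<beta> (k - ?n))" for k
  define u where "u k = (if k < ?n then u' (h k) else v (k - ?n))" for k
  show ?thesis
  proof (rule evolution_embedding[of "?n + s" \<gamma> u])
    fix k assume "k < ?n + s"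
    then show "linear_form (\<gamma> k)"
      using B lf by (auto simp: \<gamma>_def linear_form_representation)
    show "u k \<in> A"
    proof (cases "k < ?n")
      case True
      then have "h k \<in> A" using hB is_basis_subset[OF B(1)] by blast
      then have "u' (h k) \<in> A" unfolding u'_def
        by (intro subspace_diff[OF subspace_A] mult_closed sum_mem scale_mem vA) auto
      then show ?thesis using True by (simp add: u_def)
    next
      case False
      then show ?thesis using vA \<open>k < ?n + s\<close> by (simp add: u_def)
    qed
  next
    fix x y assume xy: "x \<in> A" "y \<in> A"
    let ?r = "representation B"
    have "(\<Sum>k<?n + s. (\<gamma> k x * \<gamma> k y) *s u k) =
        (\<Sum>k<?n. (?r x (h k) * ?r y (h k)) *s u' (h k)) + (\<Sum>k<s. (\<beta> k x * \<beta> k y) *s v k)"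
      by (simp add: sum_lessThan_add \<gamma>_def u_def)
    also have "(\<Sum>k<?n. (?r x (h k) * ?r y (h k)) *s u' (h k)) = (\<Sum>b\<in>B. (?r x b * ?r y b) *s u' b)"
      by (rule sum.reindex_bij_betw[OF h])
    finally show "x \<cdot> y = (\<Sum>k<?n + s. (\<gamma> k x * \<gamma> k y) *s u k)"
      using offdiag_decomposition_mult[OF B dec xy] by (simp add: u'_def)
  next
    \<comment> \<open>The coordinates with respect to \<open>B\<close> already separate
      points.\<close>
    fix x assume x: "x \<in> A" and 0: "\<And>k. k < ?n + s \<Longrightarrow> \<gamma> k x = 0"
    have "representation B x b = 0" if b: "b \<in> B" for b
    proof -
      obtain k where "k < ?n" "b = h k" using b h by (auto simp: bij_betw_def)
      then show ?thesis using 0[of k] by (simp add: \<gamma>_def)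
    qed
    then show "x = 0" using basis_expansion[OF B x] by simp
  qed
qed

section \<open>Minimality\<close>

context algebra_monomorphism
begin

text \<open>\<open>\<Phi>\<close> is linear on \<open>A\<close> only; a globally linear map that
  agrees with it there gives access to the theory of linear maps between whole spaces.\<close>

lemma linear_extension:
  obtains f where "Vector_Spaces.linear sA sE f" "\<And>x. x \<in> A \<Longrightarrow> f x = \<Phi> x"
proof -
  interpret p: vector_space_pair sA sE by unfold_locales
  obtain B where B: "B \<subseteq> A" "dom.independent B" "A \<subseteq> dom.span B"
    using dom.maximal_independent_subset by metis
  obtain f where f: "Vector_Spaces.linear sA sE f" and fB: "\<forall>x\<in>B. f x = \<Phi> x"
    using p.linear_independent_extend[OF B(2)] by blast
  have "0 \<in> A" by (rule dom.zero_mem)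
  then have \<Phi>0: "\<Phi> 0 = 0" using map_add[of 0 0] by simp
  \<comment> \<open>Membership in \<open>A\<close> is carried through the induction because
    \<open>map_add\<close> and \<open>map_scale\<close> require it.\<close>
  have "x \<in> A \<and> f x = \<Phi> x" if "x \<in> dom.span B" for x
    using that
  proof (induction rule: dom.span_induct_alt)
    case base
    then show ?case using \<Phi>0 dom.zero_mem f by (simp add: p.linear_0)
  next
    case (step c x y)
    then have "x \<in> A" "sA c x \<in> A" using B(1) dom.scale_mem by auto
    then show ?case
      using step fB f dom.subspace_add[OF dom.subspace_A]
      by (simp add: p.linear_add p.linear_scale map_add map_scale)
  qed
  then show ?thesis using that f B(3) by blast
qed

text \<open>Completing the image of \<open>A\<close> to the whole algebra takes
  \<open>card C - card B0\<close> vectors of \<open>C\<close>. Their projected squares give an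
  off-diagonal decomposition of exactly that length, for a suitable basis of
  \<open>A\<close>.\<close>

lemma eps_bound:
  assumes C: "cod.natural_basis C" "finite C"
    and B0: "dom.is_basis B0"
  shows "card B0 + dom.eps \<le> card C"
proof -
  interpret p: vector_space_pair sA sE by unfold_locales
  interpret q: vector_space_pair sE sA by unfold_locales
  obtain f where f: "Vector_Spaces.linear sA sE f" and f\<Phi>: "\<And>x. x \<in> A \<Longrightarrow> f x = \<Phi> x"
    using linear_extension by blast
  have spanB0: "dom.span B0 = A" and indB0: "dom.independent B0" and B0A: "B0 \<subseteq> A"
    using B0 dom.is_basis_subset by (auto simp: dom.is_basis_def)
  have Cb: "cod.is_basis C" and spanC: "cod.span C = E" and indC: "cod.independent C"
    and CE: "C \<subseteq> E"
    using C cod.is_basis_subset by (auto simp: cod.natural_basis_def cod.is_basis_def)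
  have injf: "inj_on f A" using inj f\<Phi> by (metis inj_on_cong)
  have fE: "f x \<in> E" if "x \<in> A" for x using maps_into f\<Phi> that by simp
  have indfB0: "cod.independent (f ` B0)"
    using p.linear_independent_injective_image[OF f indB0] injf spanB0 by simp
  \<comment> \<open>Exchange: \<open>D\<close> completes the image of \<open>B0\<close> to a basis
    of \<open>E\<close>, and the vectors added, collected in \<open>J\<close>, come from
    \<open>C\<close>.\<close>
  obtain D where D: "f ` B0 \<subseteq> D" "D \<subseteq> f ` B0 \<union> C" "cod.independent D"
      "f ` B0 \<union> C \<subseteq> cod.span D"
    using cod.maximal_independent_subset_extend[of "f ` B0" "f ` B0 \<union> C"] indfB0 by blast
  define J where "J = D - f ` B0"
  define I where "I = C - J"
  have JC: "J \<subseteq> C" using D(2) by (auto simp: J_def)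
  \<comment> \<open>Values on the independent set \<open>D\<close> may be prescribed freely: the
    inverse of \<open>f\<close> on the image of \<open>B0\<close>, and \<open>0\<close> on
    \<open>J\<close>.\<close>
  obtain \<pi> where \<pi>: "Vector_Spaces.linear sE sA \<pi>"
      and \<pi>D: "\<forall>d\<in>D. \<pi> d = (if d \<in> f ` B0 then the_inv_into B0 f d else 0)"
    using q.linear_independent_extend[OF D(3),
        of "\<lambda>d. if d \<in> f ` B0 then the_inv_into B0 f d else 0"] by blast
  have \<pi>J: "\<pi> j = 0" if "j \<in> J" for j using \<pi>D that by (simp add: J_def)
  have \<pi>f_B0: "\<pi> (f b) = b" if "b \<in> B0" for b
    using \<pi>D D(1) that injf B0A by (auto simp: the_inv_into_f_f inj_on_subset)
  have \<pi>f: "\<pi> (f x) = x" if "x \<in> A" for x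
    using that unfolding spanB0[symmetric]
  proof (induction rule: dom.span_induct_alt)
    case base
    show ?case using f \<pi> by (simp add: p.linear_0 q.linear_0)
  next
    case (step c x y)
    then show ?case using f \<pi> \<pi>f_B0
      by (simp add: p.linear_add p.linear_scale q.linear_add q.linear_scale)
  qed
  \<comment> \<open>On the span of \<open>D\<close>, \<open>f\<close> after \<open>\<pi>\<close> is
    the projection onto the image of \<open>A\<close> along the span of \<open>J\<close>.\<close>
  have \<pi>_span: "\<pi> x \<in> A \<and> x - f (\<pi> x) \<in> cod.span J" if "x \<in> cod.span D" for x
    using that
  proof (induction rule: cod.span_induct_alt)
    case base
    show ?case using f \<pi> by (simp add: p.linear_0 q.linear_0 cod.span_zero dom.zero_mem)
  next
    case (step c d y)
    have d: "\<pi> d \<in> A \<and> d - f (\<pi> d) \<in> cod.span J"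
    proof (cases "d \<in> f ` B0")
      case True
      then show ?thesis using \<pi>f_B0 B0A by (auto simp: cod.span_zero)
    next
      case False
      then have "d \<in> J" using step by (simp add: J_def)
      then show ?thesis using \<pi>J f
        by (simp add: p.linear_0 cod.span_base dom.zero_mem)
    qed
    have "sE c d + y - f (\<pi> (sE c d + y)) = sE c (d - f (\<pi> d)) + (y - f (\<pi> y))"
      using f \<pi> by (simp add: p.linear_add p.linear_scale q.linear_add q.linear_scale
          cod.scale_right_diff_distrib)
    moreover have "sE c (d - f (\<pi> d)) + (y - f (\<pi> y)) \<in> cod.span J"
      using d step by (intro cod.span_add cod.span_scale) auto
    moreover have "\<pi> (sE c d + y) \<in> A"
      using d step \<pi> dom.scale_mem dom.subspace_add[OF dom.subspace_A]
      by (simp add: q.linear_add q.linear_scale)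
    ultimately show ?case by (simp only: simp_thms)
  qed
  have E_sub: "E \<subseteq> cod.span D"
    using D(4) cod.span_minimal[of C "cod.span D"] spanC by auto
  have \<pi>A: "\<pi> x \<in> A" if "x \<in> E" for x using \<pi>_span E_sub that by blast
  \<comment> \<open>Coordinates of \<open>E\<close> pulled back to \<open>A\<close>. Those at
    \<open>J\<close> become the forms of the decomposition; those at \<open>I\<close> are dual to
    the new basis of \<open>A\<close>.\<close>
  define r where "r c x = cod.representation C (f x) c" for c x
  have lf: "dom.linear_form (r c)" for c
    unfolding dom.linear_form_def r_def using f fE
    by (simp add: p.linear_add p.linear_scale cod.representation_add[OF indC]
        cod.representation_scale[OF indC] spanC)
  \<comment> \<open>Since \<open>c' - f (\<pi> c')\<close> lies in the span of \<open>J\<close>, it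
    has no coordinate at \<open>c \<in> I\<close>; thus \<open>f (\<pi> c')\<close> and
    \<open>c'\<close> agree there.\<close>
  have r_delta: "r c (\<pi> c') = (if c = c' then 1 else 0)" if c: "c \<in> I" "c' \<in> I" for c c'
  proof -
    have c'E: "c' \<in> E" using c CE by (auto simp: I_def)
    have mem: "c' - f (\<pi> c') \<in> cod.span J" using \<pi>_span E_sub c'E by blast
    have "cod.representation C (c' - f (\<pi> c')) c = cod.representation J (c' - f (\<pi> c')) c"
      using cod.representation_extend[OF indC mem JC] by simp
    also have "\<dots> = 0"
      using cod.representation_ne_zero c(1) by (force simp: I_def)
    finally have "cod.representation C c' c = r c (\<pi> c')"
      using cod.representation_diff[OF indC, of "f (\<pi> c')" c'] c'E fE \<pi>A
      by (simp add: spanC r_def)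
    then show ?thesis using cod.representation_basis[OF indC, of c'] c by (auto simp: I_def)
  qed
  have finI: "finite I" and finJ: "finite J" using C(2) JC finite_subset by (auto simp: I_def)
  have inj\<pi>: "inj_on \<pi> I"
    by (rule inj_onI) (metis r_delta zero_neq_one)
  define B where "B = \<pi> ` I"
  have BA: "B \<subseteq> A" using \<pi>A CE by (auto simp: B_def I_def)
  have "dom.independent B"
  proof (rule dom.independent_if_scalars_zero)
    show "finite B" using finI by (simp add: B_def)
    fix g x assume 0: "(\<Sum>b\<in>B. sA (g b) b) = 0" and "x \<in> B"
    then obtain c where c: "c \<in> I" "x = \<pi> c" by (auto simp: B_def)
    \<comment> \<open>By duality, \<open>r c\<close> isolates the coefficient at
      \<open>\<pi> c\<close> in the vanishing combination.\<close>
    have "0 = r c (\<Sum>c'\<in>I. sA (g (\<pi> c')) (\<pi> c'))"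
      using 0 dom.linear_form_0[OF lf] by (simp add: B_def sum.reindex[OF inj\<pi>])
    also have "\<dots> = (\<Sum>c'\<in>I. g (\<pi> c') * r c (\<pi> c'))"
      using BA by (subst dom.linear_form_sum[OF lf])
        (auto simp: B_def dom.linear_form_scale[OF lf] image_subset_iff dom.scale_mem)
    also have "\<dots> = (\<Sum>c'\<in>I. if c' = c then g (\<pi> c) else 0)"
      using r_delta c(1) by (intro sum.cong refl) auto
    also have "\<dots> = g x" using c finI by simp
    finally show "g x = 0" by simp
  qed
  moreover have "A \<subseteq> dom.span B"
  proof
    fix x assume x: "x \<in> A"
    \<comment> \<open>Expand \<open>f x\<close> along \<open>C\<close> and project back: the terms
      at \<open>J\<close> vanish.\<close>
    have "x = \<pi> (\<Sum>c\<in>C. sE (r c x) c)"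
      using \<pi>f[OF x] cod.basis_expansion[OF Cb C(2) fE[OF x]] by (simp add: r_def)
    also have "\<dots> = (\<Sum>c\<in>C. sA (r c x) (\<pi> c))"
      using \<pi> by (simp add: q.linear_sum q.linear_scale)
    also have "\<dots> \<in> dom.span B"
    proof (intro dom.span_sum dom.span_scale)
      fix c assume "c \<in> C"
      then show "\<pi> c \<in> dom.span B"
        using \<pi>J by (cases "c \<in> J") (auto simp: B_def I_def dom.span_zero intro: dom.span_base)
    qed
    finally show "x \<in> dom.span B" .
  qed
  ultimately have B: "dom.is_basis B"
    unfolding dom.is_basis_def using dom.span_minimal[OF BA dom.subspace_A] by blast
  obtain h where h: "bij_betw h {..<card J} J"
    using finJ ex_bij_betw_nat_finite by (metis atLeast0LessThan)
  have hE: "h k \<in> E" if "k < card J" for k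
    using h that JC CE by (auto simp: bij_betw_def)
  have "dom.offdiag_decomposition B (card J) (\<lambda>k. \<pi> (mE (h k) (h k))) (\<lambda>k. r (h k))"
    unfolding dom.offdiag_decomposition_def
  proof (intro conjI allI impI ballI)
    fix b b' assume b: "b \<in> B" "b' \<in> B" "b \<noteq> b'"
    then obtain i i' where i: "i \<in> I" "b = \<pi> i" "i' \<in> I" "b' = \<pi> i'" "i \<noteq> i'"
      by (auto simp: B_def)
    have bA: "b \<in> A" "b' \<in> A" using b BA by auto
    have "f (mA b b') = mE (f b) (f b')"
      using bA map_mult f\<Phi> dom.mult_closed by simp
    also have "\<dots> = (\<Sum>c\<in>C. sE (r c b * r c b') (mE c c))"
      using cod.natural_basis_mult[OF C fE[OF bA(1)] fE[OF bA(2)]] by (simp add: r_def)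
    \<comment> \<open>A given \<open>c \<in> I\<close> differs from \<open>i\<close> or from
      \<open>i'\<close>, so one of the factors \<open>r c b\<close> and \<open>r c b'\<close> is
      zero.\<close>
    also have "\<dots> = (\<Sum>c\<in>J. sE (r c b * r c b') (mE c c))"
      using C(2) JC r_delta i by (intro sum.mono_neutral_right) (auto simp: I_def)
    finally have "\<pi> (f (mA b b')) = \<pi> (\<Sum>c\<in>J. sE (r c b * r c b') (mE c c))" by simp
    \<comment> \<open>The squares may leave the image of \<open>A\<close>; \<open>\<pi>\<close>
      brings them back and fixes the product, which already comes from \<open>A\<close>.\<close>
    then have "mA b b' = (\<Sum>c\<in>J. sA (r c b * r c b') (\<pi> (mE c c)))"
      using \<pi>f bA dom.mult_closed \<pi> by (simp add: q.linear_sum q.linear_scale)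
    then show "mA b b' = (\<Sum>k<card J. sA (r (h k) b * r (h k) b') (\<pi> (mE (h k) (h k))))"
      using sum.reindex_bij_betw[OF h, of "\<lambda>c. sA (r c b * r c b') (\<pi> (mE c c))"] by simp
  qed (use hE cod.mult_closed \<pi>A lf in auto)
  from dom.eps_le[OF B this] have "dom.eps \<le> card J" .
  moreover have "card B0 = card I"
    using dom.bases_equipotent[OF _ B B0] finI inj\<pi> by (simp add: B_def card_image)
  moreover have "card I + card J = card C"
    using JC C(2) finJ by (simp add: I_def card_Diff_subset card_mono)
  ultimately show ?thesis by linarith
qed

end

theorem theorem3p5:
  fixes sA :: "'f::field \<Rightarrow> 'a::ab_group_add \<Rightarrow> 'a"
    and A :: "'a set"
    and mA :: "'a \<Rightarrow> 'a \<Rightarrow> 'a"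
    and n :: nat
  assumes "commutative_algebra sA A mA"
    and "nonassoc_algebra.alg_dim sA A = enat n"
  shows "(\<exists>(sE :: 'f \<Rightarrow> (nat \<Rightarrow>\<^sub>0 'f) \<Rightarrow> (nat \<Rightarrow>\<^sub>0 'f)) E mE \<Phi>.
            evolution_algebra sE E mE \<and>
            nonassoc_algebra.alg_dim sE E = enat (n + nonassoc_algebra.eps sA A mA) \<and>
            algebra_monomorphism sA A mA sE E mE \<Phi> \<and>
            nonassoc_algebra.square sE E mE \<subseteq> \<Phi> ` A) \<and>
         (\<forall>(sE' :: 'f \<Rightarrow> 'e::ab_group_add \<Rightarrow> 'e) E' mE'.
            evolution_algebra sE' E' mE' \<and>
            (\<exists>\<Phi>'. algebra_monomorphism sA A mA sE' E' mE' \<Phi>') \<longrightarrow>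
            enat (n + nonassoc_algebra.eps sA A mA) \<le> nonassoc_algebra.alg_dim sE' E')"
proof -
  interpret commutative_algebra sA A mA by fact
  obtain B0 where B0: "finite B0" "is_basis B0"
    using assms(2) by (auto simp: alg_dim_def split: if_splits)
  then have n: "card B0 = n" using alg_dim_eq_enat[OF assms(2)] by blast
  obtain B v \<beta> where B: "is_basis B" "finite B" "card B = n" "offdiag_decomposition B eps v \<beta>"
    using eps_attained[OF B0(2,1)] n by metis
  show ?thesis
  proof (intro conjI allI impI)
    show "\<exists>(sE :: 'f \<Rightarrow> (nat \<Rightarrow>\<^sub>0 'f) \<Rightarrow> (nat \<Rightarrow>\<^sub>0 'f)) E mE \<Phi>.
            evolution_algebra sE E mE \<and>
            nonassoc_algebra.alg_dim sE E = enat (n + eps) \<and>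
            algebra_monomorphism sA A mA sE E mE \<Phi> \<and>
            nonassoc_algebra.square sE E mE \<subseteq> \<Phi> ` A"
      using offdiag_decomposition_embedding[OF B(1,2,4)] B(3) by simp
  next
    fix sE' :: "'f \<Rightarrow> 'e::ab_group_add \<Rightarrow> 'e" and E' mE'
    assume asm: "evolution_algebra sE' E' mE' \<and>
      (\<exists>\<Phi>'. algebra_monomorphism sA A mA sE' E' mE' \<Phi>')"
    then obtain \<Phi>' where mono: "algebra_monomorphism sA A mA sE' E' mE' \<Phi>'" by blast
    interpret E': evolution_algebra sE' E' mE' using asm by blast
    obtain C where C: "E'.natural_basis C" using E'.ex_natural_basis by blast
    then have dimE': "E'.alg_dim = (if finite C then enat (card C) else \<infinity>)"
      by (intro E'.alg_dim_eq) (simp add: E'.natural_basis_def)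
    \<comment> \<open>For infinite \<open>C\<close> the dimension is \<open>\<infinity>\<close>; the
      finite case is \<open>eps_bound\<close>.\<close>
    show "enat (n + eps) \<le> E'.alg_dim"
      using algebra_monomorphism.eps_bound[OF mono C _ B0(2)] n dimE' by auto
  qed
qed

end
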